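(* Let $X$ be a real-valued random variable whose law is absolutely continuous (with respect to Lebesgue measure on $\mathbb{R}$), with finite second moment, and satisfying the symmetry condition that $a-X$ has the same law as $X$ for some $a\in\mathbb{R}$. Let $\gamma_{+}=\mathscr{L}(X,X)$ and $\gamma_{-}=\mathscr{L}(X,a-X)$, and let $\mathcal{W}=\mathcal{W}_{d,2}$ be the Wasserstein distance of order $2$ on probability distributions on $\mathbb{R}^2$, where $d$ is the Euclidean distance on $\mathbb{R}^2$. Then $$\sup_{\gamma\in\Gamma(X,X)}\mathcal{W}(\gamma,\gamma_{+})=\mathcal{W}(\gamma_{-},\gamma_{+}).$$
   Context: $\mathscr{L}(Z)$ denotes the law of a random variable $Z$. For probability distributions $P,Q$ on a metric space $\mathbb{M}$, $\Gamma(P,Q)$ denotes the set of couplings of $P$ and $Q$, i.e. the probability distributions on $\mathbb{M}\times\mathbb{M}$ with first marginal $P$ and second marginal $Q$. For random variables $Z,Z'$, $\Gamma(Z,Z')$ is shorthand for $\Gamma(\mathscr{L}(Z),\mathscr{L}(Z'))$; thus $\Gamma(X,X)$ is the set of probability distributions on $\mathbb{R}^2$ both of whose marginals equal $\mathscr{L}(X)$. For a metric space $(\mathbb{M},d)$ and $p\ge 1$, the Wasserstein distance is $$\mathcal{W}_{d,p}(P,Q)=\left(\inf_{\gamma\in\Gamma(P,Q)}\mathbb{E}_{(Z,Z')\sim\gamma}\left(d(Z,Z')^p\right)\right)^{1/p}.$$ *)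

theory Defs
  imports "HOL-Probability.Probability"
begin

text \<open>Distributions on a metric space are probability measures on its Borel sets. On products of
  metric spaces, the library metric is the Euclidean (\<open>\<ell>\<^sub>2\<close>) combination of the factor metrics,
  see \<open>dist_prod_def\<close>.\<close>

definition couplings ::
  "'a::metric_space measure \<Rightarrow> 'a measure \<Rightarrow> ('a \<times> 'a) measure set" where
  "couplings P Q = {\<gamma>. prob_space \<gamma> \<and> sets \<gamma> = sets borel \<and>
     distr \<gamma> borel fst = P \<and> distr \<gamma> borel snd = Q}"

text \<open>The library has no real powers on \<open>ennreal\<close>; only exponents \<open>r > 0\<close> are intended.\<close>

definition ennreal_powr :: "ennreal \<Rightarrow> real \<Rightarrow> ennreal" where
  "ennreal_powr x r = (if x = \<infinity> then \<infinity> else ennreal (enn2real x powr r))"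

text \<open>Intended for \<open>p \<ge> 1\<close>. The value is \<open>ennreal\<close> because the \<open>p\<close>-th moments may be infinite.\<close>

definition wasserstein ::
  "real \<Rightarrow> 'a::metric_space measure \<Rightarrow> 'a measure \<Rightarrow> ennreal" where
  "wasserstein p P Q = ennreal_powr
     (INF \<gamma>\<in>couplings P Q. \<integral>\<^sup>+z. ennreal (dist (fst z) (snd z) powr p) \<partial>\<gamma>) (1 / p)"

end

theory Submission
  imports Defs
begin

text \<open>
  Let \<open>\<mu>\<close> be the law of \<open>X\<close>. If \<open>(U, V)\<close> has law \<open>\<gamma>\<close> and \<open>(Z, Z)\<close> has law \<open>\<gamma>\<^sub>+\<close>, then all three
  variables have law \<open>\<mu>\<close>, so the transport cost
  \<open>E[(U - Z)\<^sup>2 + (V - Z)\<^sup>2] = 4 E[X\<^sup>2] - 2 E[(U + V) Z]\<close>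
  depends on the coupling only through the cross term (\<open>transport_cost_to_diagonal\<close>). The cross
  term equals \<open>2 (E X)\<^sup>2\<close> in two situations:
  \<^item> for every \<open>\<gamma>\<close>, when \<open>(U, V)\<close> and \<open>Z\<close> are independent
    (\<open>transport_cost_independent\<close>);
  \<^item> for \<open>\<gamma> = \<gamma>\<^sub>-\<close>, under every coupling, because there \<open>U + V\<close> is the constant \<open>a = 2 E X\<close>
    (\<open>transport_cost_antidiagonal\<close>).

  So the cost \<open>4 Var X\<close> is attained from every \<open>\<gamma>\<close> by the independent coupling and cannot be
  improved from \<open>\<gamma>\<^sub>-\<close>, which makes \<open>\<gamma>\<^sub>-\<close> a farthest point from \<open>\<gamma>\<^sub>+\<close>.
\<close>

lemma ennreal_powr_mono:
  assumes "x \<le> y" "0 \<le> r"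
  shows "ennreal_powr x r \<le> ennreal_powr y r"
proof (cases "y = \<infinity>")
  case False
  with assms(1) have "x \<noteq> \<infinity>" by (auto simp: top_unique)
  moreover have "enn2real x \<le> enn2real y"
    using assms(1) False by (intro enn2real_mono) (auto simp: less_top)
  ultimately show ?thesis
    using False assms(2) by (auto simp: ennreal_powr_def intro!: ennreal_leI powr_mono2)
qed (simp add: ennreal_powr_def)

lemma pair_measure_in_couplings:
  fixes P Q :: "'a::{metric_space, second_countable_topology} measure"
  assumes "prob_space P" "prob_space Q" and sets: "sets P = sets borel" "sets Q = sets borel"
  shows "P \<Otimes>\<^sub>M Q \<in> couplings P Q"
proof -
  interpret P: prob_space P by fact
  interpret Q: prob_space Q by fact
  interpret PQ: pair_prob_space P Q ..
  have "sets (P \<Otimes>\<^sub>M Q) = sets borel"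
    by (metis sets_pair_measure_cong[OF sets] borel_prod)
  moreover have "distr (P \<Otimes>\<^sub>M Q) borel fst = P"
    using Q.distr_pair_fst[of P] distr_cong[OF refl sets(1) refl] by metis
  moreover have "distr (P \<Otimes>\<^sub>M Q) borel snd = Q"
  proof (rule measure_eqI)
    fix A assume "A \<in> sets (distr (P \<Otimes>\<^sub>M Q) borel snd)"
    then have A: "A \<in> sets Q" by (simp add: sets)
    have "snd -` A \<inter> space (P \<Otimes>\<^sub>M Q) = space P \<times> A"
      using sets.sets_into_space[OF A] by (auto simp: space_pair_measure)
    moreover have "snd \<in> P \<Otimes>\<^sub>M Q \<rightarrow>\<^sub>M borel"
      using measurable_snd measurable_cong_sets[OF refl sets(2)] by blast
    moreover have "emeasure (P \<Otimes>\<^sub>M Q) (space P \<times> A) = emeasure Q A"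
      using Q.emeasure_pair_measure_Times[OF sets.top[of P] A] P.emeasure_space_1 by simp
    ultimately show "emeasure (distr (P \<Otimes>\<^sub>M Q) borel snd) A = emeasure Q A"
      using A by (simp add: emeasure_distr sets)
  qed (simp add: sets)
  ultimately show ?thesis
    by (simp add: couplings_def PQ.prob_space_axioms)
qed

lemma couplings_marginals:
  assumes "\<gamma> \<in> couplings P Q"
  shows "prob_space \<gamma>" "sets \<gamma> = sets borel" "distr \<gamma> borel fst = P" "distr \<gamma> borel snd = Q"
  using assms by (auto simp: couplings_def)

lemma distr_in_couplings:
  fixes \<mu> :: "real measure"
  assumes "prob_space \<mu>" "sets \<mu> = sets borel"
    and f: "f \<in> borel_measurable borel" and "distr \<mu> borel f = \<mu>"
  shows "distr \<mu> borel (\<lambda>x. (x, f x)) \<in> couplings \<mu> \<mu>"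
proof -
  note [measurable] = f
  note [measurable_cong] = assms(2)
  interpret prob_space \<mu> by fact
  have "distr \<mu> borel (\<lambda>x. x) = \<mu>"
    using distr_id2[of borel \<mu>] assms(2) by simp
  then show ?thesis
    using assms(4) unfolding couplings_def
    by (simp add: distr_distr comp_def prob_space_distr borel_prod[symmetric])
qed

text \<open>Square integrability of the marginals makes all products of coordinates integrable, so the
  squares may be expanded under the integral. The second pair of coordinates is concentrated on
  the diagonal, so its first coordinate \<open>fst (snd w)\<close> stands for both.\<close>

lemma transport_cost_to_diagonal:
  fixes \<mu> :: "real measure"
  assumes \<gamma>: "\<gamma> \<in> couplings \<mu> \<mu>"
    and \<pi>: "\<pi> \<in> couplings \<gamma> (distr \<mu> borel (\<lambda>x. (x, x)))"
    and sq: "integrable \<mu> (\<lambda>x. x\<^sup>2)"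
  shows "(\<integral>\<^sup>+w. ennreal (dist (fst w) (snd w) powr 2) \<partial>\<pi>)
    = ennreal (4 * (\<integral>x. x\<^sup>2 \<partial>\<mu>) - 2 * (\<integral>w. (fst (fst w) + snd (fst w)) * fst (snd w) \<partial>\<pi>))"
proof -
  note G = couplings_marginals[OF \<gamma>] and P = couplings_marginals[OF \<pi>]
  have setsP: "sets \<pi> = sets ((borel \<Otimes>\<^sub>M borel) \<Otimes>\<^sub>M (borel \<Otimes>\<^sub>M borel))"
    unfolding borel_prod by (rule P(2))
  note [measurable_cong] = setsP
  have sets\<mu>[measurable_cong]: "sets \<mu> = sets borel" using G(3) by (metis sets_distr)
  define U V Z Z' :: "(real \<times> real) \<times> (real \<times> real) \<Rightarrow> real"
    where "U w = fst (fst w)" and "V w = snd (fst w)"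
      and "Z w = fst (snd w)" and "Z' w = snd (snd w)" for w
  note defs = U_def V_def Z_def Z'_def
  have meas[measurable]: "U \<in> borel_measurable \<pi>" "V \<in> borel_measurable \<pi>"
    "Z \<in> borel_measurable \<pi>" "Z' \<in> borel_measurable \<pi>"
    unfolding defs by measurable
  have id\<mu>: "distr \<mu> borel (\<lambda>x. x) = \<mu>"
    using distr_id2[of borel \<mu>] sets\<mu> by simp
  have fst_m: "fst \<in> \<pi> \<rightarrow>\<^sub>M (borel :: (real \<times> real) measure)"
    and snd_m: "snd \<in> \<pi> \<rightarrow>\<^sub>M (borel :: (real \<times> real) measure)"
    by (simp_all add: borel_prod[symmetric])
  have fst_b: "fst \<in> (borel :: (real \<times> real) measure) \<rightarrow>\<^sub>M (borel :: real measure)"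
    and snd_b: "snd \<in> (borel :: (real \<times> real) measure) \<rightarrow>\<^sub>M (borel :: real measure)"
    by (simp_all add: borel_prod[symmetric])
  have diag_m: "(\<lambda>x. (x, x)) \<in> \<mu> \<rightarrow>\<^sub>M (borel :: (real \<times> real) measure)"
    by (simp add: borel_prod[symmetric])
  have law: "distr \<pi> borel U = \<mu>" "distr \<pi> borel V = \<mu>" "distr \<pi> borel Z = \<mu>"
    using distr_distr[OF fst_b fst_m] distr_distr[OF snd_b fst_m] distr_distr[OF fst_b snd_m]
      distr_distr[OF fst_b diag_m] P(3,4) G(3,4) id\<mu>
    by (simp_all add: comp_def U_def[abs_def] V_def[abs_def] Z_def[abs_def])
  have "AE z in distr \<pi> borel snd. fst z = (snd z :: real)"
    unfolding P(4) using diag_m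
    by (subst AE_distr_iff) (auto simp: borel_prod[symmetric])
  then have ZZ': "AE w in \<pi>. Z' w = Z w"
    using AE_distrD[OF snd_m] by (force simp: defs)
  have sq_int: "integrable \<pi> (\<lambda>w. (f w)\<^sup>2)" "(\<integral>w. (f w)\<^sup>2 \<partial>\<pi>) = (\<integral>x. x\<^sup>2 \<partial>\<mu>)"
    if "distr \<pi> borel f = \<mu>" "f \<in> borel_measurable \<pi>" for f
    using integrable_distr_eq[of f \<pi> borel "\<lambda>x. x\<^sup>2"] integral_distr[of f \<pi> borel "\<lambda>x. x\<^sup>2"]
      that sq by auto
  note sqs = sq_int[OF law(1) meas(1)] sq_int[OF law(2) meas(2)] sq_int[OF law(3) meas(3)]
  have prod_int: "integrable \<pi> (\<lambda>w. f w * g w)"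
    if "integrable \<pi> (\<lambda>w. (f w)\<^sup>2)" "integrable \<pi> (\<lambda>w. (g w)\<^sup>2)"
      "f \<in> borel_measurable \<pi>" "g \<in> borel_measurable \<pi>" for f g :: "_ \<Rightarrow> real"
  proof (rule Bochner_Integration.integrable_bound)
    show "integrable \<pi> (\<lambda>w. (f w)\<^sup>2 + (g w)\<^sup>2)" using that by simp
    have "\<bar>x * y\<bar> \<le> x\<^sup>2 + y\<^sup>2" for x y :: real
      using sum_squares_bound[of "\<bar>x\<bar>" "\<bar>y\<bar>"] abs_ge_zero[of "x * y"]
      unfolding abs_mult mult.assoc power2_abs by linarith
    then show "AE w in \<pi>. norm (f w * g w) \<le> norm ((f w)\<^sup>2 + (g w)\<^sup>2)" by simp
  qed (use that in measurable)
  have cross: "integrable \<pi> (\<lambda>w. U w * Z w)" "integrable \<pi> (\<lambda>w. V w * Z w)"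
    using sqs by (auto intro!: prod_int)
  let ?c = "\<lambda>w. (U w)\<^sup>2 + (V w)\<^sup>2 + 2 * (Z w)\<^sup>2 - 2 * (U w * Z w + V w * Z w)"
  have c: "?c w = (U w - Z w)\<^sup>2 + (V w - Z w)\<^sup>2" for w
    by (simp add: power2_eq_square algebra_simps)
  have int_c: "integrable \<pi> ?c" using sqs cross by simp
  have dist: "dist (fst w) (snd w) powr 2 = (U w - Z w)\<^sup>2 + (V w - Z' w)\<^sup>2" for w
    by (cases "fst w = snd w")
      (auto simp: defs dist_prod_def dist_real_def)
  have "(\<integral>\<^sup>+w. ennreal (dist (fst w) (snd w) powr 2) \<partial>\<pi>) = (\<integral>\<^sup>+w. ennreal (?c w) \<partial>\<pi>)"
    using ZZ' by (intro nn_integral_cong_AE) (auto simp only: dist c)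
  also have "\<dots> = ennreal (\<integral>w. ?c w \<partial>\<pi>)"
    using int_c by (intro nn_integral_eq_integral) (simp_all only: c, simp)
  also have "(\<integral>w. ?c w \<partial>\<pi>)
      = 4 * (\<integral>x. x\<^sup>2 \<partial>\<mu>) - 2 * (\<integral>w. U w * Z w + V w * Z w \<partial>\<pi>)"
    using sqs cross by simp
  also have "(\<lambda>w. U w * Z w + V w * Z w) = (\<lambda>w. (fst (fst w) + snd (fst w)) * fst (snd w))"
    by (auto simp: defs distrib_right)
  finally show ?thesis .
qed

text \<open>Independence factorizes the cross term into \<open>E[U + V] E[Z]\<close>, and \<open>E[U + V]\<close> is twice the mean
  however \<open>U\<close> and \<open>V\<close> depend on each other. So the cost is the same for all \<open>\<gamma>\<close>.\<close>

lemma transport_cost_independent: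
  fixes \<mu> :: "real measure"
  assumes \<gamma>: "\<gamma> \<in> couplings \<mu> \<mu>" and \<mu>: "prob_space \<mu>" "sets \<mu> = sets borel"
    and sq: "integrable \<mu> (\<lambda>x. x\<^sup>2)"
  defines "\<delta> \<equiv> distr \<mu> borel (\<lambda>x. (x, x))"
  shows "\<gamma> \<Otimes>\<^sub>M \<delta> \<in> couplings \<gamma> \<delta>"
    and "(\<integral>\<^sup>+w. ennreal (dist (fst w) (snd w) powr 2) \<partial>(\<gamma> \<Otimes>\<^sub>M \<delta>))
      = ennreal (4 * (\<integral>x. x\<^sup>2 \<partial>\<mu>) - 4 * (\<integral>x. x \<partial>\<mu>)\<^sup>2)"
proof -
  note G = couplings_marginals[OF \<gamma>]
  note [measurable_cong] = \<mu>(2)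
  interpret \<mu>: prob_space \<mu> by fact
  interpret \<gamma>: prob_space \<gamma> by (rule G)
  have diag_m: "(\<lambda>x. (x, x)) \<in> \<mu> \<rightarrow>\<^sub>M (borel :: (real \<times> real) measure)"
    by (simp add: borel_prod[symmetric])
  interpret \<delta>: prob_space \<delta>
    unfolding \<delta>_def using diag_m by (rule \<mu>.prob_space_distr)
  interpret \<gamma>\<delta>: pair_prob_space \<gamma> \<delta> ..
  show coupling: "\<gamma> \<Otimes>\<^sub>M \<delta> \<in> couplings \<gamma> \<delta>"
    by (rule pair_measure_in_couplings)
      (use G \<delta>.prob_space_axioms in \<open>auto simp: \<delta>_def\<close>)
  have fst_m: "fst \<in> \<gamma> \<rightarrow>\<^sub>M (borel :: real measure)" and snd_m: "snd \<in> \<gamma> \<rightarrow>\<^sub>M (borel :: real measure)"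
    using G(2) by (simp_all add: borel_prod[symmetric] cong: measurable_cong_sets)
  have int: "integrable \<mu> (\<lambda>x. x)"
    using \<mu>.square_integrable_imp_integrable[of "\<lambda>x. x"] sq by simp
  have i: "integrable \<gamma> fst" "(\<integral>x. fst x \<partial>\<gamma>) = (\<integral>x. x \<partial>\<mu>)"
    by (rule integrable_distr[OF fst_m, of "\<lambda>x. x", unfolded G(3), OF int],
        rule integral_distr[OF fst_m measurable_ident_sets[OF refl], unfolded G(3), symmetric])
  have i': "integrable \<gamma> snd" "(\<integral>x. snd x \<partial>\<gamma>) = (\<integral>x. x \<partial>\<mu>)"
    by (rule integrable_distr[OF snd_m, of "\<lambda>x. x", unfolded G(4), OF int],
        rule integral_distr[OF snd_m measurable_ident_sets[OF refl], unfolded G(4), symmetric])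
  have fst_b: "fst \<in> (borel :: (real \<times> real) measure) \<rightarrow>\<^sub>M (borel :: real measure)"
    by (simp add: borel_prod[symmetric])
  have j: "integrable \<delta> fst" "(\<integral>z. fst z \<partial>\<delta>) = (\<integral>x. x \<partial>\<mu>)"
    unfolding \<delta>_def using int
    by (simp_all add: integrable_distr_eq[OF diag_m fst_b] integral_distr[OF diag_m fst_b])
  have k: "integrable (\<gamma> \<Otimes>\<^sub>M \<delta>) (\<lambda>w. (fst (fst w) + snd (fst w)) * fst (snd w))"
  proof (rule \<gamma>\<delta>.Fubini_integrable)
    have [measurable]: "fst \<in> borel_measurable \<gamma>" "snd \<in> borel_measurable \<gamma>"
      "fst \<in> borel_measurable \<delta>"
      using i i' j by auto
    show "(\<lambda>w. (fst (fst w) + snd (fst w)) * fst (snd w)) \<in> borel_measurable (\<gamma> \<Otimes>\<^sub>M \<delta>)"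
      by measurable
    show "integrable \<gamma> (\<lambda>y. \<integral>z. norm ((fst (fst (y, z)) + snd (fst (y, z))) * fst (snd (y, z))) \<partial>\<delta>)"
      using i i' j by (simp add: abs_mult)
  qed (use j in simp)
  have "(\<integral>w. (fst (fst w) + snd (fst w)) * fst (snd w) \<partial>(\<gamma> \<Otimes>\<^sub>M \<delta>))
      = (\<integral>y. \<integral>z. (fst y + snd y) * fst z \<partial>\<delta> \<partial>\<gamma>)"
    using \<gamma>\<delta>.integral_fst'[OF k] by simp
  also have "\<dots> = 2 * (\<integral>x. x \<partial>\<mu>)\<^sup>2"
    using i i' j by (simp add: power2_eq_square)
  finally show "(\<integral>\<^sup>+w. ennreal (dist (fst w) (snd w) powr 2) \<partial>(\<gamma> \<Otimes>\<^sub>M \<delta>))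
      = ennreal (4 * (\<integral>x. x\<^sup>2 \<partial>\<mu>) - 4 * (\<integral>x. x \<partial>\<mu>)\<^sup>2)"
    using transport_cost_to_diagonal[OF \<gamma> coupling[unfolded \<delta>_def] sq] by (simp add: \<delta>_def)
qed

text \<open>On the antidiagonal the coordinate sum is the constant \<open>a\<close>, so the cross term is \<open>a\<close> times
  the mean; and the reflection symmetry forces \<open>a\<close> to be twice the mean.\<close>

lemma transport_cost_antidiagonal:
  fixes \<mu> :: "real measure"
  assumes \<mu>: "prob_space \<mu>" "sets \<mu> = sets borel"
    and sym: "distr \<mu> borel (\<lambda>x. a - x) = \<mu>"
    and sq: "integrable \<mu> (\<lambda>x. x\<^sup>2)"
    and \<pi>: "\<pi> \<in> couplings (distr \<mu> borel (\<lambda>x. (x, a - x))) (distr \<mu> borel (\<lambda>x. (x, x)))"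
  shows "(\<integral>\<^sup>+w. ennreal (dist (fst w) (snd w) powr 2) \<partial>\<pi>)
    = ennreal (4 * (\<integral>x. x\<^sup>2 \<partial>\<mu>) - 4 * (\<integral>x. x \<partial>\<mu>)\<^sup>2)"
proof -
  note P = couplings_marginals[OF \<pi>]
  note [measurable_cong] = \<mu>(2)
  have setsP[measurable_cong]: "sets \<pi> = sets ((borel \<Otimes>\<^sub>M borel) \<Otimes>\<^sub>M (borel \<Otimes>\<^sub>M borel))"
    unfolding borel_prod by (rule P(2))
  interpret \<mu>: prob_space \<mu> by fact
  have int: "integrable \<mu> (\<lambda>x. x)"
    using \<mu>.square_integrable_imp_integrable[of "\<lambda>x. x"] sq by simp
  have "(\<integral>x. x \<partial>\<mu>) = (\<integral>x. x \<partial>distr \<mu> borel (\<lambda>x. a - x))" by (simp add: sym)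
  also have "\<dots> = (\<integral>x. a - x \<partial>\<mu>)" by (subst integral_distr) auto
  also have "\<dots> = a - (\<integral>x. x \<partial>\<mu>)" using int by (simp add: \<mu>.prob_space)
  finally have mean: "a = 2 * (\<integral>x. x \<partial>\<mu>)" by simp
  have fst_m: "fst \<in> \<pi> \<rightarrow>\<^sub>M (borel :: (real \<times> real) measure)"
    and snd_m: "snd \<in> \<pi> \<rightarrow>\<^sub>M (borel :: (real \<times> real) measure)"
    and fst_b: "fst \<in> (borel :: (real \<times> real) measure) \<rightarrow>\<^sub>M (borel :: real measure)"
    by (simp_all add: borel_prod[symmetric])
  have diag_m: "(\<lambda>x. (x, x)) \<in> \<mu> \<rightarrow>\<^sub>M (borel :: (real \<times> real) measure)"
    and anti_m: "(\<lambda>x. (x, a - x)) \<in> \<mu> \<rightarrow>\<^sub>M (borel :: (real \<times> real) measure)"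
    by (simp_all add: borel_prod[symmetric])
  have "AE y in distr \<pi> borel fst. fst y + snd y = a"
    unfolding P(3) using anti_m
    by (subst AE_distr_iff) (auto simp: borel_prod[symmetric])
  then have AE: "AE w in \<pi>. fst (fst w) + snd (fst w) = a"
    by (rule AE_distrD[OF fst_m])
  have "(\<integral>w. (fst (fst w) + snd (fst w)) * fst (snd w) \<partial>\<pi>) = (\<integral>w. a * fst (snd w) \<partial>\<pi>)"
    using AE by (intro integral_cong_AE) auto
  also have "\<dots> = a * (\<integral>z. fst z \<partial>distr \<pi> borel snd)"
    by (simp add: integral_distr[OF snd_m fst_b])
  also have "\<dots> = a * (\<integral>x. x \<partial>\<mu>)"
    unfolding P(4) by (simp add: integral_distr[OF diag_m fst_b])
  also have "\<dots> = 2 * (\<integral>x. x \<partial>\<mu>)\<^sup>2"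
    by (subst mean) (simp add: power2_eq_square)
  finally show ?thesis
    using transport_cost_to_diagonal[OF distr_in_couplings[OF \<mu> _ sym] \<pi> sq] by simp
qed

theorem theorem12:
  fixes M :: "'w measure" and X :: "'w \<Rightarrow> real" and a :: real
    and \<gamma>_plus \<gamma>_minus :: "(real \<times> real) measure"
  assumes "prob_space M"
    and "X \<in> borel_measurable M"
    and "absolutely_continuous lborel (distr M borel X)"
    and "integrable M (\<lambda>\<omega>. (X \<omega>)\<^sup>2)"
    and "distr M borel (\<lambda>\<omega>. a - X \<omega>) = distr M borel X"
  defines "\<gamma>_plus \<equiv> distr M borel (\<lambda>\<omega>. (X \<omega>, X \<omega>))"
    and "\<gamma>_minus \<equiv> distr M borel (\<lambda>\<omega>. (X \<omega>, a - X \<omega>))"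
  shows "(SUP \<gamma>\<in>couplings (distr M borel X) (distr M borel X). wasserstein 2 \<gamma> \<gamma>_plus)
    = wasserstein 2 \<gamma>_minus \<gamma>_plus"
proof -
  define \<mu> where "\<mu> = distr M borel X"
  note [measurable] = assms(2)
  have \<mu>: "prob_space \<mu>" "sets \<mu> = sets borel"
    using assms(1,2) by (auto simp: \<mu>_def prob_space.prob_space_distr)
  have sq: "integrable \<mu> (\<lambda>x. x\<^sup>2)"
    using assms(4) by (simp add: \<mu>_def integrable_distr_eq)
  have sym: "distr \<mu> borel (\<lambda>x. a - x) = \<mu>"
    using assms(5) by (simp add: \<mu>_def distr_distr comp_def)
  have plus: "\<gamma>_plus = distr \<mu> borel (\<lambda>x. (x, x))"
    and minus: "\<gamma>_minus = distr \<mu> borel (\<lambda>x. (x, a - x))"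
    by (simp_all add: \<gamma>_plus_def \<gamma>_minus_def \<mu>_def distr_distr comp_def borel_prod[symmetric])
  have minus_coupling: "\<gamma>_minus \<in> couplings \<mu> \<mu>"
    unfolding minus using \<mu> sym by (intro distr_in_couplings) auto
  define r where "r = ennreal_powr (ennreal (4 * (\<integral>x. x\<^sup>2 \<partial>\<mu>) - 4 * (\<integral>x. x \<partial>\<mu>)\<^sup>2)) (1 / 2)"
  have upper: "wasserstein 2 \<gamma> \<gamma>_plus \<le> r" if "\<gamma> \<in> couplings \<mu> \<mu>" for \<gamma>
    using transport_cost_independent[OF that \<mu> sq]
    unfolding wasserstein_def r_def plus
    by (auto intro!: ennreal_powr_mono INF_lower2)
  have minus_value: "wasserstein 2 \<gamma>_minus \<gamma>_plus = r"
  proof -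
    have "couplings \<gamma>_minus \<gamma>_plus \<noteq> {}"
      using transport_cost_independent(1)[OF minus_coupling \<mu> sq] plus by auto
    then show ?thesis
      using transport_cost_antidiagonal[OF \<mu> sym sq]
      unfolding wasserstein_def r_def plus minus by simp
  qed
  show ?thesis
    unfolding \<mu>_def[symmetric] minus_value
  proof (rule antisym)
    show "(SUP \<gamma>\<in>couplings \<mu> \<mu>. wasserstein 2 \<gamma> \<gamma>_plus) \<le> r"
      using upper by (rule SUP_least)
    show "r \<le> (SUP \<gamma>\<in>couplings \<mu> \<mu>. wasserstein 2 \<gamma> \<gamma>_plus)"
      using SUP_upper[OF minus_coupling, of "\<lambda>\<gamma>. wasserstein 2 \<gamma> \<gamma>_plus"] minus_value by simp
  qed
qed

end
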